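(* Let $K$ be a field, $R=K[x_1,\ldots,x_r]$, and let $f\in R$ be a homogeneous polynomial of degree $\deg(f)\geq d\geq 1$. Let $\ell_1,\ldots,\ell_n\in R$ be nonzero linear forms with $n\geq d$. Then the rational function $f/(\ell_1\cdots\ell_n)$ has a PFD of degree $d$ if and only if $f$ vanishes to order at least $d-n+|S|$ on every flat $S\subset[n]$ of size $|S|\geq n-d+1$ of the hyperplane arrangement associated with $\ell_1,\ldots,\ell_n$.
   Context: Notation: $[n]=\{1,\ldots,n\}$. A linear form is a homogeneous polynomial of degree 1. PFD of degree $d$: the rational function $f/(\ell_1\cdots\ell_n)$ has a partial fraction decomposition (PFD) of degree $d$ if there are polynomials $h_J\in R$, indexed by the subsets $J\subset[n]$ with $|J|=n-d$, such that $$\frac{f}{\ell_1\cdots\ell_n}=\sum_{J\subset[n],\,|J|=n-d}\frac{h_J}{\prod_{j\in J}\ell_j},\qquad \deg(h_J)\leq\deg(f)-d \text{ for all } J$$ (the zero polynomial is allowed as a numerator $h_J$). Flats: for $S\subset[n]$ let $\mathrm{rk}(S)$ be the dimension of the $K$-span of $\{\ell_i:i\in S\}$. A flat is a subset $S\subset[n]$ such that $\mathrm{rk}(S\cup\{i\})>\mathrm{rk}(S)$ for all $i\in[n]\setminus S$; equivalently, every $\ell_i$ lying in the span of $\{\ell_j:j\in S\}$ has $i\in S$. The size of the flat is the cardinality $|S|$ as a subset of $[n]$ (the $\ell_i$ need not be distinct, and are counted with repetition). Vanishing order: let $I_S=\langle \ell_i:i\in S\rangle\subset R$. A polynomial $f$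 vanishes to order at least $k$ on $S$ if $f\in (I_S)^k$. *)

theory Defs
  imports
    Complex_Main
    "HOL-Library.Poly_Mapping"
    "HOL-Computational_Algebra.Fraction_Field"
begin

section \<open>Polynomials over a field\<close>

text \<open>
  The polynomial ring \<open>K[x\<^sub>1, \<dots>, x\<^sub>r]\<close> is the monoid algebra of the monomials
  \<^typ>\<open>'x \<Rightarrow>\<^sub>0 nat\<close>, where \<^typ>\<open>'x\<close> is a finite type with \<open>r\<close> elements indexing the
  variables. A linear order on \<^typ>\<open>'x\<close> is what the library requires for the \<^class>\<open>idom\<close>
  instance, hence for the field of rational functions \<open>('x, 'k) mpoly fract\<close>; it plays no other role.
\<close>

type_synonym ('x, 'k) mpoly = "('x \<Rightarrow>\<^sub>0 nat) \<Rightarrow>\<^sub>0 'k"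

definition monom_deg :: "('x \<Rightarrow>\<^sub>0 nat) \<Rightarrow> nat" where
  "monom_deg m = (\<Sum>v\<in>Poly_Mapping.keys m. Poly_Mapping.lookup m v)"

text \<open>Convention: the zero polynomial has \<open>total_deg\<close> 0.\<close>

definition total_deg :: "('x, 'k::zero) mpoly \<Rightarrow> nat" where
  "total_deg p = Max (insert 0 (monom_deg ` Poly_Mapping.keys p))"

text \<open>The zero polynomial is homogeneous of every degree.\<close>

definition homogeneous :: "nat \<Rightarrow> ('x, 'k::zero) mpoly \<Rightarrow> bool" where
  "homogeneous e p \<longleftrightarrow> (\<forall>m\<in>Poly_Mapping.keys p. monom_deg m = e)"

abbreviation linear_form :: "('x, 'k::zero) mpoly \<Rightarrow> bool" where
  "linear_form p \<equiv> homogeneous 1 p"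

definition mpoly_scale :: "'k::field \<Rightarrow> ('x, 'k) mpoly \<Rightarrow> ('x, 'k) mpoly" where
  "mpoly_scale c p = Poly_Mapping.single 0 c * p"

global_interpretation mpoly: vector_space
  "mpoly_scale :: 'k::field \<Rightarrow> ('x, 'k) mpoly \<Rightarrow> ('x, 'k) mpoly"
  defines mpoly_span = mpoly.span
    and mpoly_dim = mpoly.dim
  by unfold_locales
    (simp_all add: mpoly_scale_def algebra_simps single_add mult_single flip: mult.assoc)


section \<open>Ideals and their powers\<close>

text \<open>The ideal generated by a set is its span in the ring regarded as a module over itself.\<close>

definition ideal_gen :: "'a::comm_ring_1 set \<Rightarrow> 'a set" where
  "ideal_gen = module.span (*)"

definition ideal_mult :: "'a::comm_ring_1 set \<Rightarrow> 'a set \<Rightarrow> 'a set" where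
  "ideal_mult I J = ideal_gen {a * b | a b. a \<in> I \<and> b \<in> J}"

primrec ideal_power :: "'a::comm_ring_1 set \<Rightarrow> nat \<Rightarrow> 'a set" where
  "ideal_power I 0 = UNIV"
| "ideal_power I (Suc k) = ideal_mult I (ideal_power I k)"


section \<open>Flats, vanishing order and partial fraction decompositions\<close>

definition rk :: "(nat \<Rightarrow> ('x, 'k::field) mpoly) \<Rightarrow> nat set \<Rightarrow> nat" where
  "rk l S = mpoly_dim (mpoly_span (l ` S))"

definition flat :: "nat \<Rightarrow> (nat \<Rightarrow> ('x, 'k::field) mpoly) \<Rightarrow> nat set \<Rightarrow> bool" where
  "flat n l S \<longleftrightarrow> S \<subseteq> {1..n} \<and> (\<forall>i\<in>{1..n} - S. rk l (S \<union> {i}) > rk l S)"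

definition vanishes_to_order ::
  "nat \<Rightarrow> (nat \<Rightarrow> ('x, 'k::field) mpoly) \<Rightarrow> nat set \<Rightarrow> ('x, 'k) mpoly \<Rightarrow> bool" where
  "vanishes_to_order k l S f \<longleftrightarrow> f \<in> ideal_power (ideal_gen (l ` S)) k"

text \<open>
  The bound \<open>deg h\<^sub>J \<le> deg f - d\<close> is written additively because of truncated subtraction, and
  \<open>h\<^sub>J = 0\<close> is listed separately because of the convention on \<open>total_deg 0\<close>.
\<close>

definition has_PFD ::
  "nat \<Rightarrow> nat \<Rightarrow> (nat \<Rightarrow> ('x::{finite,linorder}, 'k::field) mpoly) \<Rightarrow> ('x, 'k) mpoly \<Rightarrow> bool" where
  "has_PFD d n l f \<longleftrightarrow>
    (\<exists>h :: nat set \<Rightarrow> ('x, 'k) mpoly.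
      Fract f (\<Prod>i\<in>{1..n}. l i) =
        (\<Sum>J | J \<subseteq> {1..n} \<and> card J = n - d. Fract (h J) (\<Prod>j\<in>J. l j)) \<and>
      (\<forall>J. J \<subseteq> {1..n} \<and> card J = n - d \<longrightarrow>
        h J = 0 \<or> total_deg (h J) + d \<le> total_deg f))"

end

theory Submission
  imports Defs "HOL-Computational_Algebra.Polynomial_Factorial"
begin

text \<open>
  Clearing denominators, a decomposition of degree \<open>d\<close> writes \<open>f\<close> as a combination of the
  \<open>d\<close>-fold products of the \<open>l i\<close>. The ideal of these products is the intersection of the powers
  \<open>I\<^sub>S ^ (d + |S| - n)\<close> over all \<open>S\<close>; passing to the flat spanned by \<open>S\<close> leaves \<open>I\<^sub>S\<close> unchanged
  and raises the exponent, so flats suffice. One inclusion counts the factors indexed by \<open>S\<close>. The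
  other is a deletion-contraction induction on the number of forms: modulo a form \<open>x\<close> the hypotheses
  are those for the remaining forms, so \<open>f = p + g * x\<close> with \<open>p\<close> in the ideal, and cancelling \<open>x\<close> in
  \<open>f - p\<close> shows that \<open>g\<close> satisfies the hypotheses for the remaining forms and \<open>d - 1\<close>. Cancelling is
  possible because the order of vanishing along \<open>S\<close> is additive on products: it is the order at
  \<open>t = 0\<close> of the image of a polynomial under the ring homomorphism to \<open>R[t]\<close> that fixes a complement
  of the span of \<open>S\<close> and multiplies the span by \<open>t\<close>.
\<close>

section \<open>Powers of ideals\<close>

interpretation ideal: module "(*) :: 'a::comm_ring_1 \<Rightarrow> 'a \<Rightarrow> 'a"
  rewrites "module.span ((*) :: 'a \<Rightarrow> 'a \<Rightarrow> 'a) = ideal_gen"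
  by unfold_locales (simp_all add: algebra_simps ideal_gen_def)

declare ideal.scale_scale [simp del] \<comment> \<open>it undoes \<open>mult.assoc\<close>\<close>

lemma ideal_gen_singleton: "ideal_gen {a} = {b. a dvd b}"
  by (auto simp: ideal.span_singleton dvd_def image_iff mult.commute)

lemma in_ideal_gen_image_iff:
  assumes "finite I"
  shows "p \<in> ideal_gen (g ` I) \<longleftrightarrow> (\<exists>h. p = (\<Sum>i\<in>I. h i * g i))"
proof
  assume "p \<in> ideal_gen (g ` I)"
  moreover obtain J where J: "J \<subseteq> I" "inj_on g J" "g ` I = g ` J"
    by (metis subset_image_inj order_refl)
  moreover have "finite (g ` J)"
    using assms J(1) by (simp add: finite_subset)
  ultimately obtain u where "p = (\<Sum>b\<in>g ` J. u b * b)"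
    by (auto simp: ideal.span_finite)
  also have "\<dots> = (\<Sum>i\<in>J. u (g i) * g i)"
    by (simp add: sum.reindex J(2))
  also have "\<dots> = (\<Sum>i\<in>I. (if i \<in> J then u (g i) else 0) * g i)"
    using assms J(1) by (intro sum.mono_neutral_cong_left) auto
  finally show "\<exists>h. p = (\<Sum>i\<in>I. h i * g i)"
    by (intro exI[of _ "\<lambda>i. if i \<in> J then u (g i) else 0"])
next
  assume "\<exists>h. p = (\<Sum>i\<in>I. h i * g i)"
  then show "p \<in> ideal_gen (g ` I)"
    by (auto intro: ideal.span_sum ideal.span_scale ideal.span_base)
qed

lemma ideal_multI: "a \<in> I \<Longrightarrow> b \<in> J \<Longrightarrow> a * b \<in> ideal_mult I J"
  by (auto simp: ideal_mult_def intro: ideal.span_base)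

lemma ideal_mult_subset:
  assumes "\<And>a b. a \<in> I \<Longrightarrow> b \<in> J \<Longrightarrow> a * b \<in> K" and "ideal.subspace K"
  shows "ideal_mult I J \<subseteq> K"
  unfolding ideal_mult_def using assms by (intro ideal.span_minimal) auto

lemma subspace_ideal_power: "ideal.subspace (ideal_power I k)"
  by (cases k) (simp_all add: ideal_mult_def)

lemmas ideal_power_zero = ideal.subspace_0[OF subspace_ideal_power]
  and ideal_power_add = ideal.subspace_add[OF subspace_ideal_power]
  and ideal_power_scale = ideal.subspace_scale[OF subspace_ideal_power]
  and ideal_power_sum = ideal.subspace_sum[OF subspace_ideal_power]

lemma ideal_power_antimono:
  assumes "j \<le> k"
  shows "ideal_power I k \<subseteq> ideal_power I j"
  using assms
proof (rule lift_Suc_antimono_le[rotated])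
  show "ideal_power I (Suc k) \<subseteq> ideal_power I k" for k
    by (auto intro: subsetD[OF ideal_mult_subset] ideal_power_scale subspace_ideal_power)
qed

lemma subset_ideal_power_1: "I \<subseteq> ideal_power I 1"
  using ideal_multI[of _ I 1 UNIV] by auto

lemma subspace_colon:
  assumes "ideal.subspace P"
  shows "ideal.subspace {a. a * b \<in> P}"
  using assms by (auto simp: ideal.subspace_def distrib_right mult.assoc)

lemma mult_in_ideal_power:
  assumes "a \<in> ideal_power I j" and b: "b \<in> ideal_power I k"
  shows "a * b \<in> ideal_power I (j + k)"
  using assms(1)
proof (induction j arbitrary: a)
  case 0
  then show ?case using b by (simp add: ideal_power_scale)
next
  case (Suc j)
  have "ideal_mult I (ideal_power I j) \<subseteq> {a. a * b \<in> ideal_power I (Suc j + k)}"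
    by (intro ideal_mult_subset subspace_colon subspace_ideal_power)
      (simp add: mult.assoc ideal_multI Suc.IH)
  then show ?case using Suc.prems by auto
qed

lemma prod_in_ideal_power:
  assumes "finite A" and "\<And>i. i \<in> A \<Longrightarrow> g i \<in> I"
  shows "prod g A \<in> ideal_power I (card A)"
  using assms by (induction A rule: finite_induct) (simp_all add: ideal_multI)

lemma ideal_power_singleton: "ideal_power (ideal_gen {a}) k = {b. a ^ k dvd b}"
proof (induction k)
  case (Suc k)
  have "ideal_mult {b. a dvd b} {b. a ^ k dvd b} = {b. a ^ Suc k dvd b}"
  proof (rule antisym)
    show "ideal_mult {b. a dvd b} {b. a ^ k dvd b} \<subseteq> {b. a ^ Suc k dvd b}"
      by (rule ideal_mult_subset) (auto simp: ideal.subspace_def intro: mult_dvd_mono)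
    have "a * (a ^ k * c) \<in> ideal_mult {b. a dvd b} {b. a ^ k dvd b}" for c
      by (intro ideal_multI) auto
    then show "{b. a ^ Suc k dvd b} \<subseteq> ideal_mult {b. a dvd b} {b. a ^ k dvd b}"
      by (auto simp: dvd_def mult.assoc)
  qed
  then show ?case
    using Suc.IH by (simp add: ideal_gen_singleton)
qed simp

section \<open>Ring homomorphisms\<close>

locale comm_ring_hom =
  fixes \<phi> :: "'a::comm_ring_1 \<Rightarrow> 'b::comm_ring_1"
  assumes hom_add: "\<phi> (a + b) = \<phi> a + \<phi> b"
    and hom_mult: "\<phi> (a * b) = \<phi> a * \<phi> b"
    and hom_1 [simp]: "\<phi> 1 = 1"
begin

lemma hom_0 [simp]: "\<phi> 0 = 0"
  using hom_add[of 0 0] by simp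

lemma hom_prod: "\<phi> (prod g A) = (\<Prod>i\<in>A. \<phi> (g i))"
  by (induction A rule: infinite_finite_induct) (simp_all add: hom_mult)

lemma hom_in_ideal_gen: "a \<in> ideal_gen A \<Longrightarrow> \<phi> a \<in> ideal_gen (\<phi> ` A)"
  by (induction a rule: ideal.span_induct_alt)
    (auto simp: hom_add hom_mult
      intro: ideal.span_zero ideal.span_add ideal.span_scale ideal.span_base)

lemma hom_in_ideal_power:
  assumes "\<phi> ` I \<subseteq> J" and "a \<in> ideal_power I k"
  shows "\<phi> a \<in> ideal_power J k"
  using assms(2)
proof (induction k arbitrary: a)
  case (Suc k)
  let ?G = "{a * b |a b. a \<in> I \<and> b \<in> ideal_power I k}"
  have "\<phi> ` ?G \<subseteq> {a * b |a b. a \<in> J \<and> b \<in> ideal_power J k}"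
    using Suc.IH assms(1) by (force simp: hom_mult)
  moreover have "\<phi> a \<in> ideal_gen (\<phi> ` ?G)"
    using Suc.prems by (intro hom_in_ideal_gen) (simp add: ideal_mult_def)
  ultimately show ?case
    unfolding ideal_power.simps ideal_mult_def by (rule subsetD[OF ideal.span_mono])
qed simp

end

section \<open>Polynomials and their evaluation\<close>

abbreviation Const :: "'k::field \<Rightarrow> ('x, 'k) mpoly" where
  "Const \<equiv> Poly_Mapping.single 0"

definition Var :: "'x \<Rightarrow> ('x, 'k::field) mpoly" where
  "Var v = Poly_Mapping.single (Poly_Mapping.single v 1) 1"

lemma poly_mapping_induct [case_names single add]:
  assumes single: "\<And>m c. P (Poly_Mapping.single m c)"
    and add: "\<And>p q. P p \<Longrightarrow> P q \<Longrightarrow> P (p + q)"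
  shows "P (p :: 'm \<Rightarrow>\<^sub>0 'a::comm_monoid_add)"
proof (induction p rule: update_induct)
  case const
  show ?case using single[of undefined 0] by simp
next
  case (update p m c)
  have "Poly_Mapping.update m c p = p + Poly_Mapping.single m c"
    using update(1)
    by (intro poly_mapping_eqI)
      (auto simp: lookup_update lookup_add lookup_single in_keys_iff when_def)
  then show ?case using add[OF update(3) single] by simp
qed

lemma Var_power: "Var v ^ k = Poly_Mapping.single (Poly_Mapping.single v k) 1"
  by (induction k) (simp_all add: Var_def mult_single flip: single_add)

lemma single_eq_Const_mult_prod_Var:
  "Poly_Mapping.single m c = Const c * (\<Prod>v\<in>UNIV. Var v ^ Poly_Mapping.lookup m v)"
  for m :: "'x::finite \<Rightarrow>\<^sub>0 nat" and c :: "'k::field"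
proof -
  have "(\<Prod>v\<in>A. Var v ^ Poly_Mapping.lookup m v)
      = Poly_Mapping.single (\<Sum>v\<in>A. Poly_Mapping.single v (Poly_Mapping.lookup m v)) (1 :: 'k)" for A
    by (induction A rule: infinite_finite_induct) (simp_all add: Var_power mult_single)
  moreover have "(\<Sum>v\<in>UNIV. Poly_Mapping.single v (Poly_Mapping.lookup m v)) = m"
    by (rule poly_mapping_eqI) (simp add: lookup_sum lookup_single when_def)
  ultimately show ?thesis by (simp add: mult_single)
qed

lemma mpoly_induct [case_names Const Var add mult]:
  fixes p :: "('x::finite, 'k::field) mpoly"
  assumes Const: "\<And>c. P (Const c)" and Var: "\<And>v. P (Var v)"
    and add: "\<And>p q. P p \<Longrightarrow> P q \<Longrightarrow> P (p + q)"
    and mult: "\<And>p q. P p \<Longrightarrow> P q \<Longrightarrow> P (p * q)"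
  shows "P p"
proof (induction p rule: poly_mapping_induct)
  case (single m c)
  have one: "P 1" using Const[of 1] by simp
  have power: "P (Var v ^ k)" for v k
    by (induction k) (simp_all add: one Var mult)
  have "P (\<Prod>v\<in>A. Var v ^ Poly_Mapping.lookup m v)" for A
    by (induction A rule: infinite_finite_induct) (simp_all add: one power mult)
  then show ?case
    by (subst single_eq_Const_mult_prod_Var) (rule mult[OF Const])
qed (rule add)

locale mpoly_evaluation = coeff: comm_ring_hom \<kappa>
  for \<kappa> :: "'k::field \<Rightarrow> 'a::comm_ring_1" +
  fixes \<sigma> :: "'x::finite \<Rightarrow> 'a"
begin

definition eval :: "('x, 'k) mpoly \<Rightarrow> 'a" where
  "eval p = (\<Sum>m\<in>Poly_Mapping.keys p.
     \<kappa> (Poly_Mapping.lookup p m) * (\<Prod>v\<in>UNIV. \<sigma> v ^ Poly_Mapping.lookup m v))"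

lemma eval_single:
  "eval (Poly_Mapping.single m c) = \<kappa> c * (\<Prod>v\<in>UNIV. \<sigma> v ^ Poly_Mapping.lookup m v)"
  by (simp add: eval_def)

lemma eval_add: "eval (p + q) = eval p + eval q"
  unfolding eval_def
  by (rule setsum_keys_plus_distrib) (simp_all add: coeff.hom_add distrib_right)

lemma eval_single_mult:
  "eval (Poly_Mapping.single m c * q) = eval (Poly_Mapping.single m c) * eval q"
proof (induction q rule: poly_mapping_induct)
  case (single m' c')
  show ?case
    by (simp add: mult_single eval_single coeff.hom_mult lookup_add power_add prod.distrib mult_ac)
qed (simp add: distrib_left eval_add)

lemma eval_mult: "eval (p * q) = eval p * eval q"
  by (induction p rule: poly_mapping_induct)
    (simp_all add: eval_single_mult distrib_right eval_add)

lemma eval_Const [simp]: "eval (Const c) = \<kappa> c"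
  by (simp add: eval_single)

lemma eval_Var [simp]: "eval (Var v) = \<sigma> v"
proof -
  have "(\<Prod>w\<in>UNIV. \<sigma> w ^ Poly_Mapping.lookup (Poly_Mapping.single v 1) w)
      = (\<Prod>w\<in>UNIV. if w = v then \<sigma> w else 1)"
    by (intro prod.cong) (auto simp: lookup_single when_def)
  then show ?thesis by (simp add: Var_def eval_single)
qed

sublocale comm_ring_hom eval
  using eval_Const[of 1] by unfold_locales (simp_all add: eval_add eval_mult del: eval_Const)

end

section \<open>Homogeneous polynomials\<close>

lemma monom_deg_add: "monom_deg (m + m') = monom_deg m + monom_deg m'"
  unfolding monom_deg_def by (rule setsum_keys_plus_distrib) simp_all

lemma monom_deg_eq_1E:
  assumes "monom_deg m = 1"
  obtains v where "m = Poly_Mapping.single v 1"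
proof -
  obtain v where v: "v \<in> Poly_Mapping.keys m" "Poly_Mapping.lookup m v = 1"
    and others: "\<And>w. w \<in> Poly_Mapping.keys m \<Longrightarrow> v \<noteq> w \<Longrightarrow> Poly_Mapping.lookup m w = 0"
    using assms unfolding monom_deg_def sum_eq_1_iff[OF finite_keys] by auto
  have "Poly_Mapping.lookup m w = Poly_Mapping.lookup (Poly_Mapping.single v 1) w" for w
    using v others[of w]
    by (cases "w \<in> Poly_Mapping.keys m") (auto simp: lookup_single when_def in_keys_iff)
  then show ?thesis by (intro that poly_mapping_eqI)
qed

lemma homogeneous_0: "homogeneous e 0"
  by (simp add: homogeneous_def)

lemma homogeneous_single: "homogeneous (monom_deg m) (Poly_Mapping.single m c)"
  by (simp add: homogeneous_def)

lemma homogeneous_add: "homogeneous e p \<Longrightarrow> homogeneous e q \<Longrightarrow> homogeneous e (p + q)"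
  using keys_add[of p q] by (auto simp: homogeneous_def)

lemma homogeneous_mult: "homogeneous d p \<Longrightarrow> homogeneous e q \<Longrightarrow> homogeneous (d + e) (p * q)"
  using keys_mult[of p q] by (auto simp: homogeneous_def monom_deg_add)

lemma homogeneous_prod:
  fixes p :: "'i \<Rightarrow> ('x, 'k::field) mpoly"
  assumes "\<And>i. i \<in> A \<Longrightarrow> homogeneous (d i) (p i)"
  shows "homogeneous (\<Sum>i\<in>A. d i) (prod p A)"
proof -
  have "homogeneous 0 (1 :: ('x, 'k) mpoly)" by (simp add: homogeneous_def monom_deg_def)
  then show ?thesis
    using assms by (induction A rule: infinite_finite_induct) (simp_all add: homogeneous_mult)
qed

lemma subspace_homogeneous: "mpoly.subspace {p :: ('x, 'k::field) mpoly. homogeneous e p}"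
proof -
  have "homogeneous 0 (Const c :: ('x, 'k) mpoly)" for c
    by (simp add: homogeneous_def monom_deg_def)
  from homogeneous_mult[OF this] show ?thesis
    by (auto simp: mpoly.subspace_def homogeneous_0 homogeneous_add mpoly_scale_def)
qed

lemma linear_form_in_span_Var:
  assumes "linear_form y"
  shows "y \<in> mpoly_span (range Var)"
proof -
  have "y = (\<Sum>m\<in>Poly_Mapping.keys y. Poly_Mapping.single m (Poly_Mapping.lookup y m))"
    by (rule poly_mapping_eqI) (auto simp: lookup_sum lookup_single when_def in_keys_iff sum.delta)
  also have "\<dots> \<in> mpoly_span (range Var)"
  proof (rule mpoly.span_sum)
    fix m assume "m \<in> Poly_Mapping.keys y"
    then obtain v where "m = Poly_Mapping.single v 1"
      using assms monom_deg_eq_1E by (auto simp: homogeneous_def)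
    then have "Poly_Mapping.single m (Poly_Mapping.lookup y m)
        = mpoly_scale (Poly_Mapping.lookup y m) (Var v)"
      by (simp add: mpoly_scale_def mult_single Var_def)
    then show "Poly_Mapping.single m (Poly_Mapping.lookup y m) \<in> mpoly_span (range Var)"
      by (simp add: mpoly.span_scale mpoly.span_base)
  qed
  finally show ?thesis .
qed

lemma total_deg_le_homogeneous: "homogeneous e p \<Longrightarrow> total_deg p \<le> e"
  by (simp add: total_deg_def homogeneous_def)

lemma total_deg_homogeneous:
  assumes "homogeneous e p" and "p \<noteq> 0"
  shows "total_deg p = e"
proof -
  obtain m where "m \<in> Poly_Mapping.keys p" using assms(2) by fastforce
  then have "monom_deg ` Poly_Mapping.keys p = {e}"
    using assms(1) by (force simp: homogeneous_def)
  then show ?thesis by (simp add: total_deg_def)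
qed

definition homogeneous_component :: "nat \<Rightarrow> ('x, 'k::field) mpoly \<Rightarrow> ('x, 'k) mpoly" where
  "homogeneous_component e = Poly_Mapping.mapp (\<lambda>m c. c when monom_deg m = e)"

lemma lookup_homogeneous_component:
  "Poly_Mapping.lookup (homogeneous_component e p) m =
    (Poly_Mapping.lookup p m when monom_deg m = e)"
  by (auto simp: homogeneous_component_def lookup_mapp when_def in_keys_iff)

lemma homogeneous_component_add:
  "homogeneous_component e (p + q) = homogeneous_component e p + homogeneous_component e q"
  by (rule poly_mapping_eqI) (simp add: lookup_homogeneous_component lookup_add when_add_distrib)

lemma homogeneous_component_sum:
  "homogeneous_component e (sum p I) = (\<Sum>i\<in>I. homogeneous_component e (p i))"
  by (rule poly_mapping_eqI) (simp add: lookup_homogeneous_component lookup_sum when_def)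

lemma homogeneous_component_is_homogeneous: "homogeneous e (homogeneous_component e p)"
  by (simp add: homogeneous_def in_keys_iff lookup_homogeneous_component)

lemma homogeneous_component_of_homogeneous:
  "homogeneous d p \<Longrightarrow> homogeneous_component e p = (p when d = e)"
  by (rule poly_mapping_eqI)
    (auto simp: lookup_homogeneous_component homogeneous_def in_keys_iff when_def)

lemma homogeneous_component_mult_homogeneous:
  assumes "homogeneous d q"
  shows "homogeneous_component (e + d) (p * q) = homogeneous_component e p * q"
proof (induction p rule: poly_mapping_induct)
  case (single m c)
  have "homogeneous (monom_deg m + d) (Poly_Mapping.single m c * q)"
    by (intro homogeneous_mult homogeneous_single assms)
  then show ?case
    by (simp add: homogeneous_component_of_homogeneous[of "monom_deg m + d"]
        homogeneous_component_of_homogeneous[OF homogeneous_single] when_def)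
qed (simp add: distrib_right homogeneous_component_add)

lemma homogeneous_in_ideal_genE:
  fixes g :: "'i \<Rightarrow> ('x, 'k::field) mpoly"
  assumes "finite I" and g: "\<And>i. i \<in> I \<Longrightarrow> homogeneous d (g i)"
    and f: "homogeneous (e + d) f" "f \<in> ideal_gen (g ` I)"
  obtains h where "\<And>i. homogeneous e (h i)" and "f = (\<Sum>i\<in>I. h i * g i)"
proof -
  obtain h where h: "f = (\<Sum>i\<in>I. h i * g i)"
    using f(2) in_ideal_gen_image_iff[OF \<open>finite I\<close>] by blast
  have "f = homogeneous_component (e + d) f"
    by (simp add: homogeneous_component_of_homogeneous[OF f(1)])
  also have "\<dots> = (\<Sum>i\<in>I. homogeneous_component e (h i) * g i)"
    unfolding h homogeneous_component_sum using g
    by (intro sum.cong refl homogeneous_component_mult_homogeneous)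
  finally show ?thesis
    by (rule that[OF homogeneous_component_is_homogeneous])
qed

section \<open>The order of vanishing along a linear subspace\<close>

definition rees_algebra :: "'a::comm_ring_1 set \<Rightarrow> 'a poly set" where
  "rees_algebra I = {q. \<forall>j. coeff q j \<in> ideal_power I j}"

lemma pCons_in_rees_algebra:
  assumes "b \<in> I"
  shows "[:a, b:] \<in> rees_algebra I"
  using subsetD[OF subset_ideal_power_1 assms] ideal_power_zero
  by (auto simp: rees_algebra_def coeff_pCons split: nat.split simp del: ideal_power.simps(2))

lemma rees_algebra_add: "p \<in> rees_algebra I \<Longrightarrow> q \<in> rees_algebra I \<Longrightarrow> p + q \<in> rees_algebra I"
  by (simp add: rees_algebra_def ideal_power_add)

lemma rees_algebra_mult:
  assumes "p \<in> rees_algebra I" and "q \<in> rees_algebra I"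
  shows "p * q \<in> rees_algebra I"
proof -
  have "coeff p i * coeff q (n - i) \<in> ideal_power I n" if "i \<le> n" for i n
    using mult_in_ideal_power[of "coeff p i" I i "coeff q (n - i)" "n - i"] assms that
    by (simp add: rees_algebra_def)
  then show ?thesis
    by (auto simp: rees_algebra_def coeff_mult intro: ideal_power_sum)
qed

lemma poly_1_rees_algebra_in_ideal_power:
  assumes "q \<in> rees_algebra I" and "monom 1 k dvd q"
  shows "poly q 1 \<in> ideal_power I k"
proof -
  have "coeff q j \<in> ideal_power I k" for j
  proof (cases "j < k")
    case True
    then have "coeff q j = 0" using assms(2) by (auto simp: coeff_monom_mult elim!: dvdE)
    then show ?thesis by (simp add: ideal_power_zero)
  next
    case False
    then show ?thesis
      using assms(1) ideal_power_antimono[of k j I] by (auto simp: rees_algebra_def)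
  qed
  then show ?thesis by (auto simp: poly_altdef intro: ideal_power_sum)
qed

interpretation mpoly_pair: vector_space_pair
  "mpoly_scale :: 'k::field \<Rightarrow> ('x, 'k) mpoly \<Rightarrow> ('x, 'k) mpoly"
  "mpoly_scale :: 'k::field \<Rightarrow> ('x, 'k) mpoly \<Rightarrow> ('x, 'k) mpoly"
  ..

lemma mpoly_span_subset_ideal_gen: "mpoly_span U \<subseteq> ideal_gen U"
  by (rule mpoly.span_minimal)
    (auto simp: mpoly.subspace_def mpoly_scale_def
      intro: ideal.span_base ideal.span_zero ideal.span_add ideal.span_scale)

locale projection_onto_span =
  fixes \<rho> :: "('x::finite, 'k::field) mpoly \<Rightarrow> ('x, 'k) mpoly"
    and U :: "('x, 'k) mpoly set"
  assumes linear: "Vector_Spaces.linear mpoly_scale mpoly_scale \<rho>"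
    and in_span: "\<rho> y \<in> mpoly_span U"
    and fixes_span: "y \<in> mpoly_span U \<Longrightarrow> \<rho> y = y"

lemma exists_projection_onto_span: "\<exists>\<rho>. projection_onto_span \<rho> U"
proof -
  have "\<exists>\<rho>. range \<rho> \<subseteq> mpoly_span U \<and> Vector_Spaces.linear mpoly_scale mpoly_scale \<rho> \<and>
      (\<forall>y\<in>mpoly_span U. \<rho> (id y) = y)"
    by (intro mpoly_pair.linear_inj_on_left_inverse mpoly.linear_id inj_on_id)
  then show ?thesis
    by (auto simp: projection_onto_span_def)
qed

context projection_onto_span
begin

sublocale mpoly_evaluation "\<lambda>c. [:Const c:]" "\<lambda>v. [:Var v - \<rho> (Var v), \<rho> (Var v):]"
  by unfold_locales (simp_all add: single_add mult_single mult.commute one_pCons)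

lemma eval_linear_form:
  assumes "linear_form y"
  shows "eval y = [:y - \<rho> y, \<rho> y:]"
  using linear_form_in_span_Var[OF assms]
proof (induction y rule: mpoly.span_induct_alt)
  case base
  then show ?case using mpoly_pair.linear_0[OF linear] by simp
next
  case (step c x y)
  then have "eval (mpoly_scale c x) = smult (Const c) [:x - \<rho> x, \<rho> x:]"
    by (auto simp: mpoly_scale_def hom_mult)
  then show ?case
    using step.IH
    by (simp add: hom_add mpoly_pair.linear_add[OF linear] mpoly_pair.linear_scale[OF linear])
      (simp add: mpoly_scale_def right_diff_distrib)
qed

lemma poly_eval_1: "poly (eval p) 1 = p"
  by (induction p rule: mpoly_induct) (simp_all add: hom_add hom_mult)

lemma eval_eq_0_iff [simp]: "eval p = 0 \<longleftrightarrow> p = 0"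
  using poly_eval_1[of p] by auto

lemma diff_poly_eval_0_in_ideal_gen: "p - poly (eval p) 0 \<in> ideal_gen U"
proof (induction p rule: mpoly_induct)
  case (Var v)
  then show ?case using in_span mpoly_span_subset_ideal_gen by auto
next
  case (add p q)
  from ideal.span_add[OF add.IH] show ?case by (simp add: hom_add algebra_simps)
next
  case (mult p q)
  have "q * (p - poly (eval p) 0) + poly (eval p) 0 * (q - poly (eval q) 0) \<in> ideal_gen U"
    using mult.IH by (intro ideal.span_add ideal.span_scale)
  then show ?case by (simp add: hom_mult algebra_simps)
qed (simp add: ideal.span_zero)

lemma eval_in_rees_algebra: "eval p \<in> rees_algebra (ideal_gen U)"
proof (induction p rule: mpoly_induct)
  case (Const c)
  show ?case using pCons_in_rees_algebra[OF ideal.span_zero] by simp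
next
  case (Var v)
  show ?case using in_span mpoly_span_subset_ideal_gen by (auto intro: pCons_in_rees_algebra)
qed (simp_all add: hom_add hom_mult rees_algebra_add rees_algebra_mult)

lemma in_ideal_power_iff_dvd:
  assumes U: "\<And>u. u \<in> U \<Longrightarrow> linear_form u"
  shows "p \<in> ideal_power (ideal_gen U) k \<longleftrightarrow> monom 1 k dvd eval p"
proof
  have "eval u \<in> ideal_gen {monom 1 1}" if "u \<in> U" for u
  proof -
    have "eval u = [:u:] * monom 1 1"
      using that by (simp add: eval_linear_form[OF U] fixes_span mpoly.span_base monom_altdef)
    then show ?thesis by (simp only: ideal_gen_singleton mem_Collect_eq dvd_triv_right)
  qed
  then have "ideal_gen (eval ` U) \<subseteq> ideal_gen {monom 1 1}"
    by (intro ideal.span_minimal) auto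
  then have "eval ` ideal_gen U \<subseteq> ideal_gen {monom 1 1}"
    using hom_in_ideal_gen by blast
  then have "eval p \<in> ideal_power (ideal_gen {monom 1 1}) k" if "p \<in> ideal_power (ideal_gen U) k"
    using that by (rule hom_in_ideal_power)
  then show "monom 1 k dvd eval p" if "p \<in> ideal_power (ideal_gen U) k"
    using that by (simp add: ideal_power_singleton monom_power)
next
  assume "monom 1 k dvd eval p"
  from poly_1_rees_algebra_in_ideal_power[OF eval_in_rees_algebra this]
  show "p \<in> ideal_power (ideal_gen U) k" by (simp only: poly_eval_1)
qed

end

lemma mult_linear_form_in_ideal_power_iff:
  fixes f x :: "('x::{finite,linorder}, 'k::field) mpoly"
  assumes U: "\<And>u. u \<in> U \<Longrightarrow> linear_form u" and x: "linear_form x" "x \<noteq> 0"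
  shows "x * f \<in> ideal_power (ideal_gen U) (k + of_bool (x \<in> mpoly_span U))
    \<longleftrightarrow> f \<in> ideal_power (ideal_gen U) k"
proof (cases "f = 0")
  case True
  then show ?thesis by (simp add: ideal_power_zero)
next
  case False
  obtain \<rho> where "projection_onto_span \<rho> U" using exists_projection_onto_span by blast
  then interpret projection_onto_span \<rho> U .
  have in_power_iff: "p \<in> ideal_power (ideal_gen U) j \<longleftrightarrow> j \<le> order 0 (eval p)" if "p \<noteq> 0" for p j
    using that by (simp add: in_ideal_power_iff_dvd[OF U] monom_1_dvd_iff)
  have order_x: "order 0 (eval x) = of_bool (x \<in> mpoly_span U)"
  proof (cases "x \<in> mpoly_span U")
    case True
    then have "eval x = monom x 1"
      by (simp add: eval_linear_form[OF x(1)] fixes_span monom_altdef)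
    then show ?thesis using True x(2) by simp
  next
    case False
    then have "x - \<rho> x \<noteq> 0" using in_span[of x] by auto
    then show ?thesis
      using False by (simp add: eval_linear_form[OF x(1)] order_0I)
  qed
  show ?thesis
    using False x(2) order_x by (simp add: in_power_iff hom_mult order_mult)
qed

lemma exists_retraction_killing_linear_forms:
  fixes U :: "('x::finite, 'k::field) mpoly set"
  assumes U: "\<And>u. u \<in> U \<Longrightarrow> linear_form u"
  obtains \<phi> :: "('x, 'k) mpoly \<Rightarrow> ('x, 'k) mpoly"
    where "comm_ring_hom \<phi>" and "\<And>u. u \<in> U \<Longrightarrow> \<phi> u = 0" and "\<And>p. p - \<phi> p \<in> ideal_gen U"
      and "\<And>y. linear_form y \<Longrightarrow> linear_form (\<phi> y)"
proof -
  obtain \<rho> where "projection_onto_span \<rho> U" using exists_projection_onto_span by blast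
  then interpret projection_onto_span \<rho> U .
  show thesis
  proof (rule that[of "\<lambda>p. poly (eval p) 0"])
    show "comm_ring_hom (\<lambda>p. poly (eval p) 0)"
      by unfold_locales (simp_all add: hom_add hom_mult)
    show "poly (eval u) 0 = 0" if "u \<in> U" for u
      using that by (simp add: eval_linear_form[OF U] fixes_span mpoly.span_base)
    show "p - poly (eval p) 0 \<in> ideal_gen U" for p
      by (rule diff_poly_eval_0_in_ideal_gen)
    fix y :: "('x, 'k) mpoly" assume y: "linear_form y"
    have "mpoly_span U \<subseteq> {p. linear_form p}"
      using U by (intro mpoly.span_minimal subspace_homogeneous) auto
    then have "y - \<rho> y \<in> {p. linear_form p}"
      using y in_span[of y] by (intro mpoly.subspace_diff subspace_homogeneous) auto
    then show "linear_form (poly (eval y) 0)" using y by (simp add: eval_linear_form)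
  qed
qed

lemma in_ideal_gen_insert_if_retract:
  assumes retract: "\<And>p. p - \<phi> p \<in> ideal_gen {x}" and f: "\<phi> f \<in> ideal_gen (\<phi> ` P)"
  shows "f \<in> ideal_gen (insert x P)"
proof -
  have retract': "p - \<phi> p \<in> ideal_gen (insert x P)" for p
    using retract[of p] ideal.span_mono[of "{x}" "insert x P"] by auto
  have "\<phi> p \<in> ideal_gen (insert x P)" if "p \<in> P" for p
    using ideal.span_diff[OF ideal.span_base[of p "insert x P"] retract'[of p]] that by simp
  then have "ideal_gen (\<phi> ` P) \<subseteq> ideal_gen (insert x P)"
    by (intro ideal.span_minimal ideal.subspace_span) auto
  then have "\<phi> f + (f - \<phi> f) \<in> ideal_gen (insert x P)"
    using f retract' by (intro ideal.span_add) auto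
  then show ?thesis by simp
qed

section \<open>Ideals of fold products\<close>

definition fold_products :: "('i \<Rightarrow> 'a::comm_ring_1) \<Rightarrow> 'i set \<Rightarrow> nat \<Rightarrow> 'a set" where
  "fold_products l N d = prod l ` {A. A \<subseteq> N \<and> card A = d}"

definition vanishing_ideal :: "('i \<Rightarrow> 'a::comm_ring_1) \<Rightarrow> 'i set \<Rightarrow> nat \<Rightarrow> 'a set" where
  "vanishing_ideal l N d = (\<Inter>S\<in>Pow N. ideal_power (ideal_gen (l ` S)) (d + card S - card N))"

lemma prod_in_fold_products: "A \<subseteq> N \<Longrightarrow> card A = d \<Longrightarrow> prod l A \<in> fold_products l N d"
  by (auto simp: fold_products_def)

lemma fold_products_mono: "N \<subseteq> M \<Longrightarrow> fold_products l N d \<subseteq> fold_products l M d"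
  by (auto simp: fold_products_def)

lemma ideal_gen_fold_products_0: "ideal_gen (fold_products l N 0) = UNIV"
proof -
  have "1 \<in> ideal_gen (fold_products l N 0)"
    using prod_in_fold_products[of "{}" N 0 l] by (simp add: ideal.span_base)
  from ideal.span_scale[OF this] show ?thesis by auto
qed

lemma (in comm_ring_hom) fold_products_hom: "fold_products (\<phi> \<circ> l) N d = \<phi> ` fold_products l N d"
  by (simp add: fold_products_def image_image hom_prod)

lemma mult_in_ideal_gen_fold_products_insert:
  assumes "finite N" "a \<notin> N" and p: "p \<in> ideal_gen (fold_products l N d)"
  shows "p * l a \<in> ideal_gen (fold_products l (insert a N) (Suc d))"
proof -
  have "fold_products l N d \<subseteq> {p. p * l a \<in> ideal_gen (fold_products l (insert a N) (Suc d))}"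
  proof
    fix p assume "p \<in> fold_products l N d"
    then obtain A where A: "A \<subseteq> N" "card A = d" and p: "p = prod l A"
      by (auto simp: fold_products_def)
    have "finite A" "a \<notin> A" using A(1) assms(1,2) by (auto intro: finite_subset)
    then have "p * l a = prod l (insert a A)" "card (insert a A) = Suc d"
      using A(2) by (simp_all add: p mult.commute)
    moreover have "insert a A \<subseteq> insert a N" using A(1) by blast
    ultimately have "p * l a \<in> fold_products l (insert a N) (Suc d)"
      by (simp only: prod_in_fold_products)
    then show "p \<in> {p. p * l a \<in> ideal_gen (fold_products l (insert a N) (Suc d))}"
      by (simp add: ideal.span_base)
  qed
  then have "ideal_gen (fold_products l N d)
      \<subseteq> {p. p * l a \<in> ideal_gen (fold_products l (insert a N) (Suc d))}"
    by (intro ideal.span_minimal subspace_colon ideal.subspace_span)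
  then show ?thesis using p by blast
qed

lemma subspace_vanishing_ideal: "ideal.subspace (vanishing_ideal l N d)"
  unfolding vanishing_ideal_def by (intro ideal.subspace_Int subspace_ideal_power)

lemma vanishing_ideal_empty: "vanishing_ideal l {} (Suc d) = {0 :: 'a::comm_ring_1}"
proof -
  have "ideal_gen {} = ideal_gen {0 :: 'a}" by (simp add: ideal_gen_singleton)
  then have "vanishing_ideal l {} (Suc d) = ideal_power (ideal_gen {0}) (Suc d)"
    by (simp only: vanishing_ideal_def) simp
  then show ?thesis
    by (simp only: ideal_power_singleton) simp
qed

lemma prod_in_ideal_power_image:
  assumes N: "finite N" and A: "A \<subseteq> N" and S: "S \<subseteq> N"
  shows "prod l A \<in> ideal_power (ideal_gen (l ` S)) (card A + card S - card N)"
proof -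
  have fin: "finite A" "finite S" using A S N by (auto intro: finite_subset)
  have "card (A \<union> S) \<le> card N" using A S N by (intro card_mono) auto
  then have card: "card A + card S - card N \<le> card (A \<inter> S)"
    using card_Un_Int[OF fin] by simp
  have "prod l (A \<inter> S) \<in> ideal_power (ideal_gen (l ` S)) (card (A \<inter> S))"
    using fin by (intro prod_in_ideal_power) (auto intro: ideal.span_base)
  then have "prod l (A - S) * prod l (A \<inter> S)
      \<in> ideal_power (ideal_gen (l ` S)) (card A + card S - card N)"
    using ideal_power_antimono[OF card] by (intro ideal_power_scale) auto
  then show ?thesis
    using prod.Int_Diff[OF fin(1), of l S] by (simp add: mult.commute)
qed

lemma ideal_gen_fold_products_subset_vanishing_ideal:
  assumes "finite N"
  shows "ideal_gen (fold_products l N d) \<subseteq> vanishing_ideal l N d"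
proof (rule ideal.span_minimal[OF _ subspace_vanishing_ideal])
  show "fold_products l N d \<subseteq> vanishing_ideal l N d"
    using prod_in_ideal_power_image[OF assms] by (auto simp: fold_products_def vanishing_ideal_def)
qed

lemma (in comm_ring_hom) vanishing_ideal_contraction:
  assumes "finite N" "a \<notin> N" and la: "\<phi> (l a) = 0" and f: "f \<in> vanishing_ideal l (insert a N) d"
  shows "\<phi> f \<in> vanishing_ideal (\<phi> \<circ> l) N d"
  unfolding vanishing_ideal_def
proof (rule INT_I)
  fix S assume "S \<in> Pow N"
  then have S: "insert a S \<subseteq> insert a N" "finite S" "a \<notin> S"
    using assms(1,2) by (auto intro: finite_subset)
  then have "d + card (insert a S) - card (insert a N) = d + card S - card N"
    using assms(1,2) by simp
  then have "f \<in> ideal_power (ideal_gen (l ` insert a S)) (d + card S - card N)"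
    using f S(1) by (auto simp: vanishing_ideal_def dest!: bspec[of _ _ "insert a S"])
  moreover have "\<phi> ` ideal_gen (l ` insert a S) \<subseteq> ideal_gen ((\<phi> \<circ> l) ` S)"
  proof -
    have "\<phi> ` l ` insert a S \<subseteq> ideal_gen ((\<phi> \<circ> l) ` S)"
      by (auto simp: la intro: ideal.span_base ideal.span_zero)
    then have "ideal_gen (\<phi> ` l ` insert a S) \<subseteq> ideal_gen ((\<phi> \<circ> l) ` S)"
      by (intro ideal.span_minimal ideal.subspace_span)
    then show ?thesis using hom_in_ideal_gen by blast
  qed
  ultimately show "\<phi> f \<in> ideal_power (ideal_gen ((\<phi> \<circ> l) ` S)) (d + card S - card N)"
    by (intro hom_in_ideal_power)
qed

lemma vanishing_ideal_deletion:
  fixes l :: "'i \<Rightarrow> ('x::{finite,linorder}, 'k::field) mpoly"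
  assumes "finite N" "a \<notin> N" and l: "\<And>i. i \<in> insert a N \<Longrightarrow> linear_form (l i)" and "l a \<noteq> 0"
    and f: "l a * f \<in> vanishing_ideal l (insert a N) (Suc d)"
  shows "f \<in> vanishing_ideal l N d"
  unfolding vanishing_ideal_def
proof (rule INT_I)
  have vanishing: "l a * f \<in> ideal_power (ideal_gen (l ` T)) (Suc d + card T - card (insert a N))"
    if "T \<subseteq> insert a N" for T
    using f that by (simp add: vanishing_ideal_def)
  fix S assume "S \<in> Pow N"
  then have S: "S \<subseteq> insert a N" "insert a S \<subseteq> insert a N" "finite S" "a \<notin> S"
    using assms(1,2) by (auto intro: finite_subset)
  let ?I = "ideal_power (ideal_gen (l ` S))" and ?k = "d + card S - card N"
  have "l a * f \<in> ?I (?k + of_bool (l a \<in> mpoly_span (l ` S)))" if "?k > 0"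
  proof (cases "l a \<in> mpoly_span (l ` S)")
    case True
    then have "ideal_gen (l ` insert a S) = ideal_gen (l ` S)"
      using mpoly_span_subset_ideal_gen[of "l ` S"]
      unfolding ideal.span_eq by (auto intro: ideal.span_base)
    moreover have "Suc d + card (insert a S) - card (insert a N) = ?k + 1"
      using S(3,4) assms(1,2) that by simp
    ultimately show ?thesis
      using vanishing[OF S(2)] True by (simp only: of_bool_eq)
  next
    case False
    have "Suc d + card S - card (insert a N) = ?k" using assms(1,2) by simp
    then show ?thesis
      using vanishing[OF S(1)] False by (simp only: of_bool_eq add_0_right)
  qed
  moreover have "linear_form u" if "u \<in> l ` S" for u using that S(1) l by blast
  ultimately show "f \<in> ?I ?k"
    using mult_linear_form_in_ideal_power_iff[of "l ` S" "l a" f ?k] l \<open>l a \<noteq> 0\<close>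
    by (cases "?k > 0") auto
qed

lemma vanishing_ideal_reduce_modulo_form:
  fixes l :: "'i \<Rightarrow> ('x::finite, 'k::field) mpoly"
  assumes "finite N" "a \<notin> N" and l: "\<And>i. i \<in> insert a N \<Longrightarrow> linear_form (l i)"
    and f: "f \<in> vanishing_ideal l (insert a N) d"
    and contraction: "\<forall>l' :: 'i \<Rightarrow> ('x, 'k) mpoly. (\<forall>i\<in>N. linear_form (l' i)) \<longrightarrow>
      vanishing_ideal l' N d \<subseteq> ideal_gen (fold_products l' N d)"
  obtains g where "f - g * l a \<in> ideal_gen (fold_products l N d)"
proof -
  obtain \<phi> where hom: "comm_ring_hom \<phi>" and la: "\<phi> (l a) = 0"
    and retract: "\<And>p. p - \<phi> p \<in> ideal_gen {l a}"
    and forms: "\<And>y. linear_form y \<Longrightarrow> linear_form (\<phi> y)"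
    using exists_retraction_killing_linear_forms[of "{l a}"] l by auto
  interpret comm_ring_hom \<phi> by (rule hom)
  have "\<phi> f \<in> vanishing_ideal (\<phi> \<circ> l) N d"
    by (rule vanishing_ideal_contraction[of _ _ l, OF assms(1,2) la f])
  moreover have "\<forall>i\<in>N. linear_form ((\<phi> \<circ> l) i)"
    using l forms by simp
  ultimately have "\<phi> f \<in> ideal_gen (fold_products (\<phi> \<circ> l) N d)"
    using contraction by blast
  then have "f \<in> ideal_gen (insert (l a) (fold_products l N d))"
    unfolding fold_products_hom by (rule in_ideal_gen_insert_if_retract[OF retract])
  then show thesis
    by (auto simp: ideal.span_breakdown_eq intro: that)
qed

text \<open>Contraction may produce zero forms, which are therefore allowed.\<close>

lemma vanishing_ideal_subset_ideal_gen_fold_products: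
  fixes l :: "'i \<Rightarrow> ('x::{finite,linorder}, 'k::field) mpoly"
  assumes "finite N" and "\<And>i. i \<in> N \<Longrightarrow> linear_form (l i)"
  shows "vanishing_ideal l N d \<subseteq> ideal_gen (fold_products l N d)"
  using assms
proof (induction N arbitrary: l d rule: finite_induct)
  case empty
  show ?case
    by (cases d) (simp_all add: ideal_gen_fold_products_0 vanishing_ideal_empty ideal.span_zero)
next
  case (insert a N)
  let ?P = "\<lambda>N. ideal_gen (fold_products l N d)"
  have mono: "?P N \<subseteq> ?P (insert a N)"
    by (intro ideal.span_mono fold_products_mono) auto
  have IH: "\<forall>l' :: 'i \<Rightarrow> ('x, 'k) mpoly. (\<forall>i\<in>N. linear_form (l' i)) \<longrightarrow>
      vanishing_ideal l' N d \<subseteq> ideal_gen (fold_products l' N d)" for d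
    using insert.IH by blast
  show ?case
  proof
    fix f assume f: "f \<in> vanishing_ideal l (insert a N) d"
    obtain g where g: "f - g * l a \<in> ?P N"
      by (rule vanishing_ideal_reduce_modulo_form[OF insert.hyps insert.prems f IH])
    have "g * l a \<in> ?P (insert a N)"
    proof (cases "l a = 0 \<or> d = 0")
      case False
      then obtain d' where d: "d = Suc d'" by (cases d) auto
      have "f - g * l a \<in> vanishing_ideal l (insert a N) d"
        using g mono ideal_gen_fold_products_subset_vanishing_ideal[of "insert a N" l d]
          insert.hyps(1) by auto
      from ideal.subspace_diff[OF subspace_vanishing_ideal f this]
      have "l a * g \<in> vanishing_ideal l (insert a N) (Suc d')"
        by (simp add: d mult.commute)
      then have "g \<in> vanishing_ideal l N d'"
        using insert.hyps insert.prems False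
        by (intro vanishing_ideal_deletion[of N a l g d']) auto
      then show ?thesis
        using insert.hyps insert.prems IH unfolding d
        by (intro mult_in_ideal_gen_fold_products_insert) auto
    qed (auto simp: ideal_gen_fold_products_0 ideal.span_zero)
    then have "(f - g * l a) + g * l a \<in> ?P (insert a N)"
      using g mono by (intro ideal.span_add) auto
    then show "f \<in> ?P (insert a N)" by simp
  qed
qed

theorem ideal_gen_fold_products_eq_vanishing_ideal:
  fixes l :: "'i \<Rightarrow> ('x::{finite,linorder}, 'k::field) mpoly"
  assumes "finite N" and "\<And>i. i \<in> N \<Longrightarrow> linear_form (l i)"
  shows "ideal_gen (fold_products l N d) = vanishing_ideal l N d"
  using assms
  by (intro antisym ideal_gen_fold_products_subset_vanishing_ideal
      vanishing_ideal_subset_ideal_gen_fold_products)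

section \<open>Flats\<close>

lemma (in vector_space) dim_insert_notin_span:
  assumes "finite S" and "x \<notin> span S"
  shows "dim (insert x S) = Suc (dim S)"
proof -
  obtain B where B: "B \<subseteq> S" "independent B" "S \<subseteq> span B"
    by (rule maximal_independent_subset)
  have span: "span S = span B"
    using B by (simp add: span_eq subset_trans[OF B(1) span_superset])
  have x: "x \<notin> span B" using assms(2) span by simp
  then have "independent (insert x B)" using B(2) by (rule independent_insertI)
  moreover have "span (insert x S) = span (insert x B)"
    using span by (simp add: span_insert)
  ultimately have "dim (insert x S) = card (insert x B)"
    using dim_span_eq_card_independent dim_span by metis
  also have "\<dots> = Suc (card B)"
    using assms(1) B(1) x by (intro card_insert_disjoint) (auto intro: finite_subset span_base)
  also have "card B = dim S"
    using dim_span_eq_card_independent[OF B(2)] span dim_span by metis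
  finally show ?thesis .
qed

definition flat_closure :: "nat \<Rightarrow> (nat \<Rightarrow> ('x, 'k::field) mpoly) \<Rightarrow> nat set \<Rightarrow> nat set" where
  "flat_closure n l S = {i \<in> {1..n}. l i \<in> mpoly_span (l ` S)}"

lemma subset_flat_closure: "S \<subseteq> {1..n} \<Longrightarrow> S \<subseteq> flat_closure n l S"
  by (auto simp: flat_closure_def mpoly.span_base)

lemma flat_flat_closure: "flat n l (flat_closure n l S)"
  unfolding flat_def
proof (intro conjI ballI)
  let ?T = "flat_closure n l S"
  show "?T \<subseteq> {1..n}" by (auto simp: flat_closure_def)
  then have "finite (l ` ?T)" by (simp add: finite_subset)
  moreover fix i assume i: "i \<in> {1..n} - ?T"
  moreover have "mpoly_span (l ` ?T) \<subseteq> mpoly_span (l ` S)"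
    by (rule mpoly.span_minimal) (auto simp: flat_closure_def)
  ultimately have "mpoly_dim (insert (l i) (l ` ?T)) = Suc (mpoly_dim (l ` ?T))"
    by (intro mpoly.dim_insert_notin_span) (auto simp: flat_closure_def)
  then show "rk l (?T \<union> {i}) > rk l ?T"
    by (simp add: rk_def)
qed

lemma ideal_gen_flat_closure:
  assumes "S \<subseteq> {1..n}"
  shows "ideal_gen (l ` flat_closure n l S) = ideal_gen (l ` S)"
  unfolding ideal.span_eq
  using subset_flat_closure[OF assms, of l] mpoly_span_subset_ideal_gen[of "l ` S"]
  by (auto simp: flat_closure_def intro: ideal.span_base)

lemma vanishes_on_flats_iff_in_vanishing_ideal:
  assumes "d \<le> n"
  shows "(\<forall>S. flat n l S \<and> card S \<ge> n - d + 1 \<longrightarrow> vanishes_to_order (d + card S - n) l S f)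
    \<longleftrightarrow> f \<in> vanishing_ideal l {1..n} d"
proof
  assume flats: "\<forall>S. flat n l S \<and> card S \<ge> n - d + 1 \<longrightarrow> vanishes_to_order (d + card S - n) l S f"
  have "f \<in> ideal_power (ideal_gen (l ` S)) (d + card S - n)" if S: "S \<subseteq> {1..n}" for S
  proof (cases "d + card S \<le> n")
    case False
    let ?T = "flat_closure n l S"
    have "card S \<le> card ?T"
      using subset_flat_closure[OF S, of l] by (intro card_mono) (auto simp: flat_closure_def)
    then have le: "d + card S - n \<le> d + card ?T - n" and "card ?T \<ge> n - d + 1"
      using False \<open>d \<le> n\<close> by auto
    then have "f \<in> ideal_power (ideal_gen (l ` S)) (d + card ?T - n)"
      using flats flat_flat_closure[of n l S] ideal_gen_flat_closure[OF S, of l]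
      by (auto simp: vanishes_to_order_def)
    then show ?thesis using ideal_power_antimono[OF le] by blast
  qed simp
  then show "f \<in> vanishing_ideal l {1..n} d" by (simp add: vanishing_ideal_def)
qed (simp add: vanishing_ideal_def vanishes_to_order_def flat_def)

section \<open>Partial fraction decompositions\<close>

lemma Fract_eq_sum_Fract_iff:
  fixes f :: "'a::idom"
  assumes N: "finite N" and nonzero: "prod l N \<noteq> 0" and \<J>: "\<And>J. J \<in> \<J> \<Longrightarrow> J \<subseteq> N"
  shows "Fract f (prod l N) = (\<Sum>J\<in>\<J>. Fract (h J) (prod l J)) \<longleftrightarrow>
    f = (\<Sum>J\<in>\<J>. h J * prod l (N - J))"
proof -
  have prod_N: "prod l N = prod l J * prod l (N - J)" if "J \<in> \<J>" for J
    by (simp add: prod.subset_diff[OF \<J>[OF that] N] mult.commute)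
  have "Fract (h J) (prod l J) = to_fract (h J * prod l (N - J)) / to_fract (prod l N)"
    if "J \<in> \<J>" for J
    using nonzero prod_N[OF that] by (simp add: Fract_conv_to_fract)
  then have sum: "(\<Sum>J\<in>\<J>. Fract (h J) (prod l J))
      = to_fract (\<Sum>J\<in>\<J>. h J * prod l (N - J)) / to_fract (prod l N)"
    by (simp add: sum_divide_distrib)
  show ?thesis
    using nonzero
    by (simp only: sum Fract_conv_to_fract[of f] divide_cancel_right
        to_fract_eq_0_iff to_fract_eq_iff simp_thms)
qed

lemma bij_betw_Diff_subsets_card:
  assumes "finite N" and "d \<le> card N"
  shows "bij_betw (\<lambda>J. N - J) {J. J \<subseteq> N \<and> card J = card N - d} {A. A \<subseteq> N \<and> card A = d}"
  using assms
  by (intro bij_betw_byWitness[where f' = "\<lambda>A. N - A"]) (auto simp: card_Diff_subset finite_subset)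

lemma has_PFD_iff_sum_prod:
  assumes "d \<le> n" and "prod l {1..n} \<noteq> 0"
  shows "has_PFD d n l f \<longleftrightarrow>
    (\<exists>h. f = (\<Sum>A | A \<subseteq> {1..n} \<and> card A = d. h A * prod l A) \<and>
      (\<forall>A. A \<subseteq> {1..n} \<and> card A = d \<longrightarrow> h A = 0 \<or> total_deg (h A) + d \<le> total_deg f))"
    (is "_ \<longleftrightarrow> ?sum_prod")
proof -
  let ?N = "{1..n}"
  let ?\<J> = "{J. J \<subseteq> ?N \<and> card J = n - d}" and ?\<A> = "{A. A \<subseteq> ?N \<and> card A = d}"
  have bij: "bij_betw (\<lambda>J. ?N - J) ?\<J> ?\<A>"
    using bij_betw_Diff_subsets_card[of ?N d] \<open>d \<le> n\<close> by simp
  have cleared: "has_PFD d n l f \<longleftrightarrow> (\<exists>h. f = (\<Sum>J\<in>?\<J>. h J * prod l (?N - J)) \<and>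
      (\<forall>J\<in>?\<J>. h J = 0 \<or> total_deg (h J) + d \<le> total_deg f))"
    unfolding has_PFD_def using assms(2) by (subst Fract_eq_sum_Fract_iff) auto
  show ?thesis
  proof
    assume "has_PFD d n l f"
    then obtain h where f: "f = (\<Sum>J\<in>?\<J>. h J * prod l (?N - J))"
      and deg: "\<forall>J\<in>?\<J>. h J = 0 \<or> total_deg (h J) + d \<le> total_deg f"
      unfolding cleared by blast
    have "f = (\<Sum>J\<in>?\<J>. h (?N - (?N - J)) * prod l (?N - J))"
      unfolding f by (intro sum.cong refl) (simp add: double_diff)
    also have "\<dots> = (\<Sum>A\<in>?\<A>. h (?N - A) * prod l A)"
      by (rule sum.reindex_bij_betw[OF bij])
    finally have "f = (\<Sum>A\<in>?\<A>. h (?N - A) * prod l A)" .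
    moreover have "?N - A \<in> ?\<J>" if "A \<in> ?\<A>" for A
      using that finite_subset[of A ?N] by (simp add: card_Diff_subset)
    ultimately show ?sum_prod
      using deg by (intro exI[of _ "\<lambda>A. h (?N - A)"]) blast
  next
    assume ?sum_prod
    then obtain h where f: "f = (\<Sum>A\<in>?\<A>. h A * prod l A)"
      and deg: "\<forall>A\<in>?\<A>. h A = 0 \<or> total_deg (h A) + d \<le> total_deg f"
      by blast
    have "f = (\<Sum>J\<in>?\<J>. h (?N - J) * prod l (?N - J))"
      unfolding f by (rule sum.reindex_bij_betw[OF bij, symmetric])
    then show "has_PFD d n l f"
      unfolding cleared using deg bij_betw_apply[OF bij]
      by (intro exI[of _ "\<lambda>J. h (?N - J)"]) blast
  qed
qed

lemma has_PFD_iff_in_ideal_gen_fold_products: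
  fixes f :: "('x::{finite,linorder}, 'k::field) mpoly"
  assumes f: "homogeneous e f" and "d \<le> e" "d \<le> n"
    and l: "\<And>i. i \<in> {1..n} \<Longrightarrow> linear_form (l i)" "\<And>i. i \<in> {1..n} \<Longrightarrow> l i \<noteq> 0"
  shows "has_PFD d n l f \<longleftrightarrow> f \<in> ideal_gen (fold_products l {1..n} d)"
proof -
  let ?\<A> = "{A. A \<subseteq> {1..n} \<and> card A = d}"
  have "prod l {1..n} \<noteq> 0" using l(2) by simp
  note PFD_iff = has_PFD_iff_sum_prod[OF \<open>d \<le> n\<close> this]
  show ?thesis
  proof
    assume "has_PFD d n l f"
    then show "f \<in> ideal_gen (fold_products l {1..n} d)"
      unfolding PFD_iff fold_products_def by (subst in_ideal_gen_image_iff) auto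
  next
    assume ideal: "f \<in> ideal_gen (fold_products l {1..n} d)"
    have "homogeneous d (prod l A)" if "A \<in> ?\<A>" for A
    proof -
      have "homogeneous (\<Sum>i\<in>A. 1) (prod l A)"
        using l(1) that by (intro homogeneous_prod) blast
      then show ?thesis using that by simp
    qed
    then obtain h where h: "\<And>A. homogeneous (e - d) (h A)" "f = (\<Sum>A\<in>?\<A>. h A * prod l A)"
      using homogeneous_in_ideal_genE[of ?\<A> d "prod l" "e - d" f] f ideal \<open>d \<le> e\<close>
      by (auto simp: fold_products_def)
    show "has_PFD d n l f"
    proof (cases "f = 0")
      case True
      then show ?thesis unfolding PFD_iff by (intro exI[of _ "\<lambda>_. 0"]) simp
    next
      case False
      have "total_deg (h A) + d \<le> total_deg f" for A
        using total_deg_le_homogeneous[OF h(1)] total_deg_homogeneous[OF f False] \<open>d \<le> e\<close>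
        by (simp add: le_diff_conv2)
      with h(2) show ?thesis unfolding PFD_iff by blast
    qed
  qed
qed

theorem theorem1p2:
  fixes f :: "('x::{finite,linorder}, 'k::field) mpoly"
    and l :: "nat \<Rightarrow> ('x, 'k) mpoly"
    and d e n :: nat
  assumes "homogeneous e f" and "e \<ge> d" and "d \<ge> 1"
    and "\<And>i. i \<in> {1..n} \<Longrightarrow> linear_form (l i) \<and> l i \<noteq> 0"
    and "n \<ge> d"
  shows "has_PFD d n l f \<longleftrightarrow>
    (\<forall>S. flat n l S \<and> card S \<ge> n - d + 1 \<longrightarrow> vanishes_to_order (d + card S - n) l S f)"
proof -
  have "has_PFD d n l f \<longleftrightarrow> f \<in> ideal_gen (fold_products l {1..n} d)"
    using assms by (intro has_PFD_iff_in_ideal_gen_fold_products) auto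
  also have "ideal_gen (fold_products l {1..n} d) = vanishing_ideal l {1..n} d"
    using assms(4) by (intro ideal_gen_fold_products_eq_vanishing_ideal) auto
  also have "f \<in> \<dots> \<longleftrightarrow>
      (\<forall>S. flat n l S \<and> card S \<ge> n - d + 1 \<longrightarrow> vanishes_to_order (d + card S - n) l S f)"
    by (rule vanishes_on_flats_iff_in_vanishing_ideal[OF \<open>n \<ge> d\<close>, symmetric])
  finally show ?thesis .
qed

end
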